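(* Suppose that Conjecture (PP) stated in the context holds. Let $T$ be a locally finite simplicial tree. Then a discrete subgroup of $\mathrm{Isom}(T)$ is locally free if and only if it contains no non-trivial elliptic element.
   Context: A group is locally free if every finitely generated subgroup of it is free. Let $T$ be a simplicial tree with vertex set $V(T)$ and standard path metric $d$ (each edge has length $1$); $T$ is identified with its geometric realization. Every isometry considered is assumed to act on $T$ without inversions (this can be arranged by subdividing edges). The translation length of an isometry $g$ is $l(g)=\min_{x\in V(T)}d(x,gx)$. If $l(g)=0$, $g$ is elliptic (it fixes a vertex). If $l(g)>0$, $g$ is hyperbolic, and its axis is the bi-infinite path in $T$ on which $g$ acts by translations of length $l(g)$. The isometry group $\mathrm{Isom}(T)$ carries the topology of pointwise convergence; a subgroup is discrete if its subspace topology is the discrete topology. For an $n$-tuple $X=(g_1,\dots,g_n)$ of isometries of a simplicial tree define $$L(X)=\sum_{1\le i\le n} l(g_i)+\sum_{1\le i<j\le n}\bigl(l(g_ig_j)+l(g_ig_j^{-1})\bigr).$$ For $j\in\{1,\dots,n\}$ and subsets $S_1,S_2\subseteq\{1,\dots,n\}\setminus\{j\}$, let $X^{j}_{S_1,S_2}$ be the $n$-tuple obtained from $X$ by leaving $g_j$ unchanged and, for $i\ne j$, replacing $g_i$ by: $g_jg_i$ if $i\in S_1\setminus S_2$; $g_ig_j^{-1}$ if $i\in S_2\setminus S_1$; $g_jg_ig_j^{-1}$ if $i\in S_1\cap S_2$; $g_i$ otherwise. The tuple $X$ is minimal if $L(X)\le L(X^{j}_{S_1,S_2})$ for every $j\in\{1,\dots,n\}$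 and all $S_1,S_2\subseteq\{1,\dots,n\}\setminus\{j\}$. For hyperbolic $g_i,g_j$ with axes $\gamma_i,\gamma_j$, the projection of $\gamma_j$ onto $\gamma_i$ is $\mathrm{Proj}_{\gamma_i}(\gamma_j)=\{x\in\gamma_i: d(x,\gamma_j)=d(\gamma_i,\gamma_j)\}$; it is the unique vertex of $\gamma_i$ closest to $\gamma_j$ if $\gamma_i\cap\gamma_j=\varnothing$, and equals $\gamma_i\cap\gamma_j$ otherwise. An $n$-tuple $X=(g_1,\dots,g_n)$ satisfies the hypotheses of the Ping Pong Lemma if all $g_i$ are hyperbolic, with axes $\gamma_1,\dots,\gamma_n$, and for each $1\le i\le n$ there is an open segment $P_i\subseteq\gamma_i$ of length $l(g_i)$ (endpoints not required to be vertices) such that $\bigcup_{j\neq i}\mathrm{Proj}_{\gamma_i}(\gamma_j)\subseteq P_i$. Conjecture (PP): for every $n$ and every $n$-tuple $X=(g_1,\dots,g_n)$ of isometries of a simplicial tree, if $X$ is minimal then either some $g_i$ is elliptic, or $X$ satisfies the hypotheses of the Ping Pong Lemma. *)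

theory Defs
  imports
    "HOL-Analysis.Function_Topology"
    "HOL-Algebra.Bij"
    "HOL-Algebra.Generated_Groups"
begin

section \<open>Free and locally free groups\<close>

text \<open>
  A letter \<open>(s, True)\<close> stands for the generator \<open>s\<close> and \<open>(s, False)\<close> for its formal inverse;
  words are lists of letters.
\<close>

definition reduced_word :: "('a \<times> bool) list \<Rightarrow> bool" where
  "reduced_word w \<longleftrightarrow>
     successively (\<lambda>x y. \<not> (fst x = fst y \<and> snd x \<noteq> snd y)) w"

definition eval_word :: "('a, 'b) monoid_scheme \<Rightarrow> ('a \<times> bool) list \<Rightarrow> 'a" where
  "eval_word G w =
     foldr (\<lambda>(s, b) y. (if b then s else inv\<^bsub>G\<^esub> s) \<otimes>\<^bsub>G\<^esub> y) w \<one>\<^bsub>G\<^esub>"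

text \<open>
  The elements of the free group on \<open>S\<close> are the reduced words over \<open>S\<close>, so \<open>S\<close> is a free basis
  of \<open>G\<close> iff the canonical evaluation map from the free group on \<open>S\<close> to \<open>G\<close> is bijective.
  The trivial group is free, with empty basis.
\<close>

definition free_basis :: "('a, 'b) monoid_scheme \<Rightarrow> 'a set \<Rightarrow> bool" where
  "free_basis G S \<longleftrightarrow>
     S \<subseteq> carrier G \<and>
     bij_betw (eval_word G) {w. reduced_word w \<and> fst ` set w \<subseteq> S} (carrier G)"

definition free_group :: "('a, 'b) monoid_scheme \<Rightarrow> bool" where
  "free_group G \<longleftrightarrow> group G \<and> (\<exists>S. free_basis G S)"

definition locally_free_group :: "('a, 'b) monoid_scheme \<Rightarrow> bool" where
  "locally_free_group G \<longleftrightarrow>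
     group G \<and> (\<forall>A. finite A \<and> A \<subseteq> carrier G \<longrightarrow> free_group (subgroup_generated G A))"


section \<open>Simplicial trees\<close>

text \<open>
  A simplicial tree is given by its vertex set \<open>V\<close> and its adjacency relation \<open>E\<close> (each
  unoriented edge being represented by both of its orientations).
\<close>

definition circuit :: "('v \<times> 'v) set \<Rightarrow> 'v list \<Rightarrow> bool" where
  "circuit E xs \<longleftrightarrow>
     3 \<le> length xs \<and> distinct xs \<and> successively (\<lambda>x y. (x, y) \<in> E) xs \<and> (last xs, hd xs) \<in> E"

definition simplicial_tree :: "'v set \<Rightarrow> ('v \<times> 'v) set \<Rightarrow> bool" where
  "simplicial_tree V E \<longleftrightarrow>
     V \<noteq> {} \<and> E \<subseteq> V \<times> V \<and> sym E \<and> irrefl E \<and>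
     (\<forall>x\<in>V. \<forall>y\<in>V. (x, y) \<in> E\<^sup>*) \<and>
     (\<nexists>xs. circuit E xs)"

definition locally_finite_tree :: "'v set \<Rightarrow> ('v \<times> 'v) set \<Rightarrow> bool" where
  "locally_finite_tree V E \<longleftrightarrow> simplicial_tree V E \<and> (\<forall>x\<in>V. finite {y. (x, y) \<in> E})"

definition path_dist :: "('v \<times> 'v) set \<Rightarrow> 'v \<Rightarrow> 'v \<Rightarrow> nat" where
  "path_dist E x y = (LEAST n. (x, y) \<in> E ^^ n)"

definition set_path_dist :: "('v \<times> 'v) set \<Rightarrow> 'v set \<Rightarrow> 'v set \<Rightarrow> nat" where
  "set_path_dist E A B = (LEAST n. \<exists>x\<in>A. \<exists>y\<in>B. n = path_dist E x y)"


section \<open>The isometry group\<close>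

text \<open>
  Isometries are simplicial, i.e. they act on the vertex set.  As in the library's treatment of
  permutation groups, they are extensional functions on \<open>V\<close>.
\<close>

definition tree_isometries :: "'v set \<Rightarrow> ('v \<times> 'v) set \<Rightarrow> ('v \<Rightarrow> 'v) set" where
  "tree_isometries V E =
     {g \<in> Bij V. \<forall>x\<in>V. \<forall>y\<in>V. path_dist E (g x) (g y) = path_dist E x y}"

definition Isom :: "'v set \<Rightarrow> ('v \<times> 'v) set \<Rightarrow> ('v \<Rightarrow> 'v) monoid" where
  "Isom V E = BijGroup V \<lparr>carrier := tree_isometries V E\<rparr>"

text \<open>
  The topology of pointwise convergence.  Distinct vertices have distance at least \<open>1\<close>, so the
  metric topology on \<open>V\<close> is discrete.
\<close>

definition Isom_topology :: "'v set \<Rightarrow> ('v \<times> 'v) set \<Rightarrow> ('v \<Rightarrow> 'v) topology" where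
  "Isom_topology V E =
     subtopology (product_topology (\<lambda>_. discrete_topology V) V) (carrier (Isom V E))"

definition discrete_subgroup :: "'v set \<Rightarrow> ('v \<times> 'v) set \<Rightarrow> ('v \<Rightarrow> 'v) set \<Rightarrow> bool" where
  "discrete_subgroup V E \<Gamma> \<longleftrightarrow>
     subgroup \<Gamma> (Isom V E) \<and> subtopology (Isom_topology V E) \<Gamma> = discrete_topology \<Gamma>"

definition inversion :: "('v \<times> 'v) set \<Rightarrow> ('v \<Rightarrow> 'v) \<Rightarrow> bool" where
  "inversion E g \<longleftrightarrow> (\<exists>x y. (x, y) \<in> E \<and> g x = y \<and> g y = x)"

definition without_inversions :: "('v \<times> 'v) set \<Rightarrow> ('v \<Rightarrow> 'v) set \<Rightarrow> bool" where
  "without_inversions E \<Gamma> \<longleftrightarrow> (\<forall>g\<in>\<Gamma>. \<not> inversion E g)"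

definition translation_length :: "'v set \<Rightarrow> ('v \<times> 'v) set \<Rightarrow> ('v \<Rightarrow> 'v) \<Rightarrow> nat" where
  "translation_length V E g = (LEAST n. \<exists>x\<in>V. n = path_dist E x (g x))"

definition elliptic :: "'v set \<Rightarrow> ('v \<times> 'v) set \<Rightarrow> ('v \<Rightarrow> 'v) \<Rightarrow> bool" where
  "elliptic V E g \<longleftrightarrow> translation_length V E g = 0"

definition hyperbolic :: "'v set \<Rightarrow> ('v \<times> 'v) set \<Rightarrow> ('v \<Rightarrow> 'v) \<Rightarrow> bool" where
  "hyperbolic V E g \<longleftrightarrow> translation_length V E g > 0"


section \<open>Axes, projections and the Ping Pong hypotheses\<close>

definition bi_infinite_path :: "('v \<times> 'v) set \<Rightarrow> (int \<Rightarrow> 'v) \<Rightarrow> bool" where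
  "bi_infinite_path E c \<longleftrightarrow> inj c \<and> (\<forall>k. (c k, c (k + 1)) \<in> E)"

definition is_axis :: "'v set \<Rightarrow> ('v \<times> 'v) set \<Rightarrow> ('v \<Rightarrow> 'v) \<Rightarrow> 'v set \<Rightarrow> bool" where
  "is_axis V E g \<gamma> \<longleftrightarrow>
     (\<exists>c. bi_infinite_path E c \<and> \<gamma> = range c \<and>
          (\<forall>k. g (c k) = c (k + int (translation_length V E g))))"

text \<open>
  Bi-infinite paths, their projections and their open segments are represented by the sets of
  vertices they contain.  A projection of one axis onto another is a subtree of the latter whose
  end points, if any, are vertices, and open segments are convex; hence a projection lies in an
  open segment iff its vertices do.
\<close>

definition axis_projection :: "('v \<times> 'v) set \<Rightarrow> 'v set \<Rightarrow> 'v set \<Rightarrow> 'v set" where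
  "axis_projection E \<gamma> \<gamma>' = {x \<in> \<gamma>. set_path_dist E {x} \<gamma>' = set_path_dist E \<gamma> \<gamma>'}"

text \<open>
  \<open>P\<close> is the set of vertices in an open segment of length \<open>r\<close> of the path \<open>\<gamma>\<close>.  Identifying
  \<open>\<gamma>\<close> with the real line, vertices being the integers, the segment is the interval from
  \<open>a\<close> to \<open>a + r\<close>, where \<open>a\<close> may be any real number.
\<close>

definition open_segment_in :: "('v \<times> 'v) set \<Rightarrow> 'v set \<Rightarrow> nat \<Rightarrow> 'v set \<Rightarrow> bool" where
  "open_segment_in E \<gamma> r P \<longleftrightarrow>
     (\<exists>c a. bi_infinite_path E c \<and> \<gamma> = range c \<and>
            P = {c k | k. a < real_of_int k \<and> real_of_int k < a + real r})"

text \<open>An \<open>n\<close>-tuple is a function \<open>X\<close> of which only the values on \<open>{1..n}\<close> matter.\<close>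

definition ping_pong_hypotheses ::
  "'v set \<Rightarrow> ('v \<times> 'v) set \<Rightarrow> nat \<Rightarrow> (nat \<Rightarrow> 'v \<Rightarrow> 'v) \<Rightarrow> bool" where
  "ping_pong_hypotheses V E n X \<longleftrightarrow>
     (\<forall>i\<in>{1..n}. hyperbolic V E (X i)) \<and>
     (\<exists>\<gamma>. (\<forall>i\<in>{1..n}. is_axis V E (X i) (\<gamma> i)) \<and>
          (\<forall>i\<in>{1..n}. \<exists>P. open_segment_in E (\<gamma> i) (translation_length V E (X i)) P \<and>
                            (\<Union>j\<in>{1..n} - {i}. axis_projection E (\<gamma> i) (\<gamma> j)) \<subseteq> P))"


section \<open>Minimal tuples\<close>

definition tuple_length ::
  "'v set \<Rightarrow> ('v \<times> 'v) set \<Rightarrow> nat \<Rightarrow> (nat \<Rightarrow> 'v \<Rightarrow> 'v) \<Rightarrow> nat" where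
  "tuple_length V E n X =
     (\<Sum>i\<in>{1..n}. translation_length V E (X i)) +
     (\<Sum>i\<in>{1..n}. \<Sum>j\<in>{i<..n}.
        translation_length V E (X i \<otimes>\<^bsub>Isom V E\<^esub> X j) +
        translation_length V E (X i \<otimes>\<^bsub>Isom V E\<^esub> inv\<^bsub>Isom V E\<^esub> (X j)))"

definition tuple_move ::
  "('a, 'b) monoid_scheme \<Rightarrow> (nat \<Rightarrow> 'a) \<Rightarrow> nat \<Rightarrow> nat set \<Rightarrow> nat set \<Rightarrow> nat \<Rightarrow> 'a" where
  "tuple_move G X j S1 S2 i =
     (if i = j then X j
      else if i \<in> S1 - S2 then X j \<otimes>\<^bsub>G\<^esub> X i
      else if i \<in> S2 - S1 then X i \<otimes>\<^bsub>G\<^esub> inv\<^bsub>G\<^esub> (X j)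
      else if i \<in> S1 \<inter> S2 then X j \<otimes>\<^bsub>G\<^esub> X i \<otimes>\<^bsub>G\<^esub> inv\<^bsub>G\<^esub> (X j)
      else X i)"

definition minimal_tuple ::
  "'v set \<Rightarrow> ('v \<times> 'v) set \<Rightarrow> nat \<Rightarrow> (nat \<Rightarrow> 'v \<Rightarrow> 'v) \<Rightarrow> bool" where
  "minimal_tuple V E n X \<longleftrightarrow>
     (\<forall>j\<in>{1..n}. \<forall>S1 S2. S1 \<subseteq> {1..n} - {j} \<and> S2 \<subseteq> {1..n} - {j} \<longrightarrow>
        tuple_length V E n X \<le> tuple_length V E n (tuple_move (Isom V E) X j S1 S2))"

text \<open>
  Conjecture (PP) for all trees with vertices in a given type.  The standing assumption that
  there are no inversions is imposed on all elements of the group generated by the tuple.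
\<close>

definition conjecture_PP :: "'v itself \<Rightarrow> bool" where
  "conjecture_PP (_ :: 'v itself) \<longleftrightarrow>
     (\<forall>(V :: 'v set) E n X.
        simplicial_tree V E \<and>
        (\<forall>i\<in>{1..n}. X i \<in> carrier (Isom V E)) \<and>
        without_inversions E (generate (Isom V E) (X ` {1..n})) \<and>
        minimal_tuple V E n X \<longrightarrow>
        (\<exists>i\<in>{1..n}. elliptic V E (X i)) \<or> ping_pong_hypotheses V E n X)"

end

theory Submission
  imports Defs "HOL-Algebra.Group_Action"
begin

text \<open>
  If the group is locally free, an elliptic element \<open>g\<close> generates a free group inside the stabiliser
  of a vertex.  Discreteness and local finiteness make that stabiliser finite
  (\<open>finite_stabilizer\<close>), and a finite free group is trivial
  (\<open>finite_free_group_trivial\<close>), so \<open>g = 1\<close>.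

  Conversely, suppose that the identity is the only elliptic element and let \<open>H\<close> be a finitely
  generated subgroup.  Take a generating set of \<open>H\<close> of least cardinality \<open>n\<close>, and
  among all generating \<open>n\<close>-tuples one of least total length \<open>L\<close>.  The moves in the definition of
  a minimal tuple are invertible, hence lead from generating tuples to generating tuples, and so
  the chosen tuple is minimal (\<open>ex_minimal_tuple\<close>).  An elliptic entry would be the identity and could be dropped,
  against the choice of \<open>n\<close>.  Conjecture (PP) therefore provides the hypotheses of the Ping Pong
  Lemma, and the tuple freely generates \<open>H\<close> (\<open>ping_pong_tuple_free\<close>).

  The Ping Pong Lemma itself rests on one fact about trees.  Send each vertex \<open>v\<close> to its nearest
  vertex, its foot, on each axis.  If the foot of \<open>v\<close> on an axis \<open>\<gamma>'\<close> is outside the projection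
  of an axis \<open>\<gamma>\<close> onto \<open>\<gamma>'\<close>, then \<open>v\<close> can reach \<open>\<gamma>\<close> only through that projection, so its
  foot on \<open>\<gamma>\<close> is in the projection of \<open>\<gamma>'\<close> onto \<open>\<gamma>\<close> (\<open>foot_in_projection\<close>).  Hence a vertex
  has its foot outside the chosen segment \<open>P\<^sub>i\<close> for at most one \<open>i\<close>, and since \<open>g\<^sub>i\<close> moves feet on
  its own axis by the length of \<open>P\<^sub>i\<close>, the sets of vertices whose foot lies beyond or before \<open>P\<^sub>i\<close>
  are ping-pong sets for \<open>g\<^sub>i\<close> and its inverse.
\<close>

section \<open>Free bases and reduced words\<close>

lemma eval_word_Nil [simp]: "eval_word G [] = \<one>\<^bsub>G\<^esub>"
  by (simp add: eval_word_def)

lemma eval_word_Cons [simp]: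
  "eval_word G (a # w) = (if snd a then fst a else inv\<^bsub>G\<^esub> fst a) \<otimes>\<^bsub>G\<^esub> eval_word G w"
  by (simp add: eval_word_def split: prod.splits)

lemma reduced_word_Nil [simp]: "reduced_word []"
  by (simp add: reduced_word_def)

lemma reduced_word_Cons:
  "reduced_word (a # w) \<longleftrightarrow> (w = [] \<or> hd w \<noteq> (fst a, \<not> snd a)) \<and> reduced_word w"
  by (cases w) (auto simp: reduced_word_def prod_eq_iff)

lemma reduced_word_append:
  "reduced_word (u @ v) \<longleftrightarrow> reduced_word u \<and> reduced_word v \<and>
     (u = [] \<or> v = [] \<or> hd v \<noteq> (fst (last u), \<not> snd (last u)))"
  unfolding reduced_word_def successively_append_iff by (auto simp: prod_eq_iff)

definition inverse_word :: "('a \<times> bool) list \<Rightarrow> ('a \<times> bool) list" where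
  "inverse_word w = rev (map (apsnd Not) w)"

lemma reduced_inverse_word: "reduced_word w \<Longrightarrow> reduced_word (inverse_word w)"
  by (auto simp: inverse_word_def reduced_word_def successively_map
      elim!: successively_mono)

lemma inverse_word_Nil [simp]: "inverse_word [] = []"
  by (simp add: inverse_word_def)

lemma inverse_word_Cons [simp]: "inverse_word (a # w) = inverse_word w @ [apsnd Not a]"
  by (simp add: inverse_word_def)

lemma fst_set_inverse_word [simp]: "fst ` set (inverse_word w) = fst ` set w"
  by (force simp: inverse_word_def)

context group
begin

lemma eval_word_closed:
  "fst ` set w \<subseteq> carrier G \<Longrightarrow> eval_word G w \<in> carrier G"
  by (induction w) auto

lemma eval_word_append:
  "fst ` set u \<subseteq> carrier G \<Longrightarrow> fst ` set v \<subseteq> carrier G \<Longrightarrow>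
   eval_word G (u @ v) = eval_word G u \<otimes> eval_word G v"
  by (induction u) (auto simp: eval_word_closed m_assoc)

lemma eval_inverse_word:
  "fst ` set w \<subseteq> carrier G \<Longrightarrow> eval_word G (inverse_word w) = inv (eval_word G w)"
proof (induction w)
  case (Cons a w)
  have "eval_word G (inverse_word (a # w)) = inv (eval_word G w) \<otimes> eval_word G [apsnd Not a]"
    using Cons by (simp add: eval_word_append)
  also have "\<dots> = inv (eval_word G (a # w))"
    using Cons by (auto simp: inv_mult_group eval_word_closed)
  finally show ?case .
qed simp

text \<open>
  Prefixing a letter to a reduced word either keeps it reduced or cancels its first letter.
\<close>

lemma ex_reduced_word:
  "fst ` set w \<subseteq> S \<Longrightarrow> S \<subseteq> carrier G \<Longrightarrow>
   \<exists>u. reduced_word u \<and> fst ` set u \<subseteq> S \<and> eval_word G u = eval_word G w"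
proof (induction w)
  case (Cons a w)
  then obtain u where u: "reduced_word u" "fst ` set u \<subseteq> S" "eval_word G u = eval_word G w"
    by auto
  have a: "fst a \<in> S" "fst a \<in> carrier G"
    using Cons.prems by auto
  show ?case
  proof (cases "u \<noteq> [] \<and> hd u = (fst a, \<not> snd a)")
    case True
    then obtain u' where u': "u = (fst a, \<not> snd a) # u'"
      by (cases u) auto
    have "eval_word G u' \<in> carrier G"
      using u u' Cons.prems by (intro eval_word_closed) auto
    then have "eval_word G (a # w) = eval_word G u'"
      using a by (auto simp flip: u(3) m_assoc simp: u')
    then show ?thesis
      using u u' by (intro exI[of _ u']) (auto simp: reduced_word_Cons)
  next
    case False
    then show ?thesis
      using u a by (intro exI[of _ "a # u"]) (auto simp: reduced_word_Cons)
  qed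
qed (auto intro!: exI[of _ "[]"])

lemma generate_subset_eval_words:
  assumes "S \<subseteq> carrier G" "g \<in> generate G S"
  shows "\<exists>w. fst ` set w \<subseteq> S \<and> eval_word G w = g"
  using assms(2)
proof induction
  case one
  show ?case by (intro exI[of _ "[]"]) auto
next
  case (incl h)
  then show ?case using assms(1) by (intro exI[of _ "[(h, True)]"]) auto
next
  case (inv h)
  then show ?case using assms(1) by (intro exI[of _ "[(h, False)]"]) auto
next
  case (eng h1 h2)
  then obtain u v where "fst ` set u \<subseteq> S" "eval_word G u = h1"
    "fst ` set v \<subseteq> S" "eval_word G v = h2" by blast
  then show ?case
    using assms(1) by (intro exI[of _ "u @ v"]) (auto simp: eval_word_append image_Un)
qed

text \<open>
  Evaluation on reduced words is injective as soon as no non-empty reduced word evaluates to the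
  identity: after cancelling a common prefix of \<open>u\<close> and \<open>v\<close>, the word
  \<open>inverse_word u @ v\<close> is itself reduced.
\<close>

lemma free_basisI:
  assumes S: "S \<subseteq> carrier G" "generate G S = carrier G"
    and nontrivial: "\<And>w. reduced_word w \<Longrightarrow> fst ` set w \<subseteq> S \<Longrightarrow> w \<noteq> [] \<Longrightarrow> eval_word G w \<noteq> \<one>"
  shows "free_basis G S"
proof -
  have inj: "u = v" if "reduced_word u" "fst ` set u \<subseteq> S" "reduced_word v" "fst ` set v \<subseteq> S"
    "eval_word G u = eval_word G v" for u v
    using that
  proof (induction u arbitrary: v)
    case Nil
    then show ?case using nontrivial[of v] by auto
  next
    case (Cons a u)
    have v: "v \<noteq> []"
      using Cons.prems nontrivial[of "a # u"] by fastforce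
    then obtain b v' where v': "v = b # v'" by (cases v) auto
    have clo: "eval_word G u \<in> carrier G" "eval_word G v' \<in> carrier G" "fst a \<in> carrier G"
      using Cons.prems S v' by (auto intro!: eval_word_closed)
    show ?case
    proof (cases "a = b")
      case True
      then have "eval_word G u = eval_word G v'"
        using Cons.prems(5) clo v' by (auto split: if_splits)
      then show ?thesis
        using Cons True v' by (auto simp: reduced_word_Cons)
    next
      case False
      have "b \<noteq> (fst a, \<not> snd (apsnd Not a))"
        using False by (cases a) auto
      then have "reduced_word (inverse_word (a # u) @ v)"
        using reduced_inverse_word[OF Cons.prems(1)] Cons.prems(3) v'
        by (subst reduced_word_append) simp
      moreover have "fst ` set (inverse_word (a # u) @ v) \<subseteq> S"
        using Cons.prems(2,4) by (simp only: set_append image_Un fst_set_inverse_word Un_subset_iff simp_thms)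
      ultimately have "eval_word G (inverse_word (a # u) @ v) \<noteq> \<one>"
        using v by (intro nontrivial) simp_all
      moreover have "eval_word G (inverse_word (a # u) @ v) = inv (eval_word G v) \<otimes> eval_word G v"
      proof -
        have "fst ` set (a # u) \<subseteq> carrier G" "fst ` set v \<subseteq> carrier G"
          using Cons.prems S(1) by blast+
        then show ?thesis
          using eval_word_append[of "inverse_word (a # u)" v] eval_inverse_word[of "a # u"] Cons.prems(5)
          by (simp only: fst_set_inverse_word)
      qed
      ultimately show ?thesis
        using Cons.prems(4) S(1) eval_word_closed[of v] l_inv by (metis subset_trans)
    qed
  qed
  have "eval_word G ` {w. reduced_word w \<and> fst ` set w \<subseteq> S} = carrier G"
  proof
    show "eval_word G ` {w. reduced_word w \<and> fst ` set w \<subseteq> S} \<subseteq> carrier G"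
      using S(1) by (auto intro!: eval_word_closed)
    show "carrier G \<subseteq> eval_word G ` {w. reduced_word w \<and> fst ` set w \<subseteq> S}"
    proof
      fix g assume "g \<in> carrier G"
      then have "g \<in> generate G S"
        using S(2) by simp
      then obtain w where w: "fst ` set w \<subseteq> S" "eval_word G w = g"
        by (metis generate_subset_eval_words[OF S(1)])
      obtain u where "reduced_word u" "fst ` set u \<subseteq> S" "eval_word G u = eval_word G w"
        by (metis ex_reduced_word[OF w(1) S(1)])
      then show "g \<in> eval_word G ` {w. reduced_word w \<and> fst ` set w \<subseteq> S}"
        using w(2) by (intro image_eqI[of _ _ u]) simp_all
    qed
  qed
  then show ?thesis
    using S(1) inj by (auto simp: free_basis_def bij_betw_def inj_on_def)
qed

text \<open>
  The powers of a single basis element already give infinitely many reduced words.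
\<close>

lemma finite_free_group_trivial:
  assumes "free_group G" "finite (carrier G)"
  shows "carrier G = {\<one>}"
proof -
  obtain S where S: "S \<subseteq> carrier G"
    and bij: "bij_betw (eval_word G) {w. reduced_word w \<and> fst ` set w \<subseteq> S} (carrier G)"
    using assms(1) by (auto simp: free_group_def free_basis_def)
  have fin: "finite {w. reduced_word w \<and> fst ` set w \<subseteq> S}"
    using bij_betw_finite[OF bij] assms(2) by simp
  have "S = {}"
  proof (rule ccontr)
    assume "S \<noteq> {}"
    then obtain s where s: "s \<in> S" by auto
    have "reduced_word (replicate n (s, True))" for n
      by (induction n) (auto simp: reduced_word_Cons)
    then have "range (\<lambda>n. replicate n (s, True)) \<subseteq> {w. reduced_word w \<and> fst ` set w \<subseteq> S}"
      using s by auto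
    moreover have "inj (\<lambda>n. replicate n (s, True))"
      by (auto intro!: injI)
    ultimately show False
      using fin finite_subset finite_imageD infinite_UNIV_nat by blast
  qed
  then have "{w. reduced_word w \<and> fst ` set w \<subseteq> S} = {[]}"
    by auto
  then show ?thesis
    using bij by (auto simp: bij_betw_def)
qed

end

section \<open>Ping pong for group actions\<close>

text \<open>
  A reduced word applied to a point outside the two sets of its last letter ends up in the set of
  its first letter: when the next
  letter acts, the point is in the set of the previous letter, which is not the inverse letter because the
  word is reduced, so the point is moved into the set of the new letter.
\<close>

lemma (in group_action) ping_pong:
  fixes A :: "'a \<Rightarrow> bool \<Rightarrow> 'c set"
  assumes S: "S \<subseteq> carrier G" "generate G S = carrier G"
    and forward: "\<And>s x. s \<in> S \<Longrightarrow> x \<in> E - A s False \<Longrightarrow> \<phi> s x \<in> A s True"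
    and backward: "\<And>s x. s \<in> S \<Longrightarrow> x \<in> E - A s True \<Longrightarrow> \<phi> (inv s) x \<in> A s False"
    and opposite: "\<And>s. s \<in> S \<Longrightarrow> A s True \<inter> A s False = {}"
    and disjoint: "\<And>s t b c. s \<in> S \<Longrightarrow> t \<in> S \<Longrightarrow> s \<noteq> t \<Longrightarrow> A s b \<inter> A t c = {}"
    and base: "\<And>s. s \<in> S \<Longrightarrow> E - A s True - A s False \<noteq> {}"
  shows "free_basis G S"
proof -
  interpret G: group G using group_hom group_hom.axioms(1) by blast
  let ?letter = "\<lambda>a. if snd a then fst a else inv\<^bsub>G\<^esub> fst a"
  have play: "\<phi> (eval_word G w) x \<in> A (fst (hd w)) (snd (hd w))"
    if "reduced_word w" "fst ` set w \<subseteq> S" "w \<noteq> []" "x \<in> E"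
      "x \<notin> A (fst (last w)) True" "x \<notin> A (fst (last w)) False" for w x
    using that
  proof (induction w)
    case (Cons a w)
    define y where "y = \<phi> (eval_word G w) x"
    have clo: "fst a \<in> carrier G" "eval_word G w \<in> carrier G" "fst a \<in> S"
      using Cons.prems S(1) by (auto intro!: G.eval_word_closed)
    have y: "y \<in> E"
      using element_image[OF clo(2)] Cons.prems(4) by (simp add: y_def)
    have eq: "\<phi> (eval_word G (a # w)) x = \<phi> (?letter a) y"
      using composition_rule[OF Cons.prems(4), of "?letter a" "eval_word G w"] clo
      by (simp add: y_def)
    have "y \<notin> A (fst a) (\<not> snd a)"
    proof (cases "w = []")
      case True
      then have "y = x"
        using id_eq_one Cons.prems(4) unfolding y_def by (metis eval_word_Nil restrict_apply')
      then show ?thesis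
        using Cons.prems(5,6) True by (cases "snd a") auto
    next
      case False
      have IH: "y \<in> A (fst (hd w)) (snd (hd w))"
        using Cons False unfolding y_def by (auto simp: reduced_word_Cons)
      have hd: "fst (hd w) \<in> S" "hd w \<noteq> (fst a, \<not> snd a)"
        using Cons.prems False by (auto simp: reduced_word_Cons)
      show ?thesis
      proof (cases "fst (hd w) = fst a")
        case True
        then have "snd (hd w) = snd a" using hd by (auto simp: prod_eq_iff)
        then show ?thesis
          using IH True opposite[OF clo(3)] by (cases "snd a") auto
      next
        case False
        then show ?thesis
          using IH disjoint[OF hd(1) clo(3)] by blast
      qed
    qed
    then show ?case
      using eq y forward[OF clo(3)] backward[OF clo(3)] by (cases "snd a") auto
  qed simp
  show ?thesis
  proof (rule G.free_basisI[OF S])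
    fix w assume w: "reduced_word w" "fst ` set w \<subseteq> S" "w \<noteq> []"
    show "eval_word G w \<noteq> \<one>\<^bsub>G\<^esub>"
    proof
      assume one: "eval_word G w = \<one>\<^bsub>G\<^esub>"
      define a where "a = last w"
      have "a \<in> set w"
        using w by (simp add: a_def)
      then have a: "fst a \<in> S" "fst a \<in> carrier G"
        using w S(1) by auto
      obtain x where x: "x \<in> E" "x \<notin> A (fst a) True" "x \<notin> A (fst a) False"
        using base[OF a(1)] by auto
      have fixed: "\<phi> \<one>\<^bsub>G\<^esub> x = x"
        using id_eq_one x(1) by (metis restrict_apply')
      show False
      proof (cases "fst (hd w) = fst a")
        case True
        then show ?thesis
          using play[OF w x(1)] x fixed one by (cases "snd (hd w)") (auto simp: a_def)
      next
        case False
        \<comment> \<open>If \<open>w\<close> begins and ends with different generators, the start point might lie in the set of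
          the first letter.  The conjugate of \<open>w\<close> by its last letter is reduced and begins and ends with the
          same generator.\<close>
        define u where "u = (fst a, \<not> snd a) # w @ [a]"
        have "reduced_word u"
          using w False by (auto simp: u_def reduced_word_Cons reduced_word_append a_def prod_eq_iff)
        moreover have "fst ` set u \<subseteq> S" using w a by (auto simp: u_def)
        moreover have "eval_word G u = \<one>\<^bsub>G\<^esub>"
          using w S(1) a one
          by (auto simp: u_def G.eval_word_append)
        ultimately show ?thesis
          using play[of u x] x fixed by (cases "snd a") (auto simp: u_def)
      qed
    qed
  qed
qed

section \<open>Geometry of simplicial trees\<close>

locale tree =
  fixes V :: "'v set" and E :: "('v \<times> 'v) set"
  assumes tree: "simplicial_tree V E"
begin

abbreviation d where "d \<equiv> path_dist E"

lemma edge_in_V: "(x, y) \<in> E \<Longrightarrow> x \<in> V \<and> y \<in> V"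
  using tree by (auto simp: simplicial_tree_def)

lemma edge_sym: "(x, y) \<in> E \<Longrightarrow> (y, x) \<in> E"
  using tree by (auto simp: simplicial_tree_def dest: symD)

lemma edge_irrefl: "(x, x) \<notin> E"
  using tree by (auto simp: simplicial_tree_def irrefl_def)

lemma no_circuit: "\<not> circuit E xs"
  using tree by (auto simp: simplicial_tree_def)

lemma dist_le: "(x, y) \<in> E ^^ n \<Longrightarrow> d x y \<le> n"
  by (simp add: path_dist_def Least_le)

lemma relpow_dist: "x \<in> V \<Longrightarrow> y \<in> V \<Longrightarrow> (x, y) \<in> E ^^ d x y"
  unfolding path_dist_def
  by (rule LeastI_ex) (rule rtrancl_imp_relpow, use tree in \<open>simp add: simplicial_tree_def\<close>)

lemma dist_self [simp]: "d x x = 0"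
  using dist_le[of x x 0] by simp

lemma dist_eq_0: "x \<in> V \<Longrightarrow> y \<in> V \<Longrightarrow> d x y = 0 \<longleftrightarrow> x = y"
  using relpow_dist[of x y] by auto

lemma dist_sym: "d x y = d y x"
proof -
  have "(y, x) \<in> E ^^ n" if "(x, y) \<in> E ^^ n" for x y n
    using that
  proof (induction n arbitrary: x)
    case (Suc n)
    then obtain z where "(x, z) \<in> E" "(z, y) \<in> E ^^ n"
      by (metis relpow_Suc_D2)
    then show ?case
      using Suc.IH edge_sym relpow_Suc_I by metis
  qed simp
  then have "(x, y) \<in> E ^^ n \<longleftrightarrow> (y, x) \<in> E ^^ n" for n
    by blast
  then show ?thesis
    by (simp add: path_dist_def)
qed

lemma dist_triangle: "x \<in> V \<Longrightarrow> y \<in> V \<Longrightarrow> z \<in> V \<Longrightarrow> d x z \<le> d x y + d y z"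
  using relpow_dist[of x y] relpow_dist[of y z]
  by (intro dist_le) (auto simp: relpow_add)

lemma dist_edge_le: "v \<in> V \<Longrightarrow> (x, y) \<in> E \<Longrightarrow> d v y \<le> d v x + 1"
  using dist_triangle[of v x y] dist_le[of x y 1] edge_in_V[of x y] by force

lemma ex_closer_neighbour:
  assumes "v \<in> V" "x \<in> V" "x \<noteq> v"
  shows "\<exists>y. (x, y) \<in> E \<and> d v x = d v y + 1"
proof -
  obtain n where n: "d v x = Suc n"
    using dist_eq_0[of v x] assms by (cases "d v x") auto
  then have "(v, x) \<in> E ^^ Suc n"
    using relpow_dist[of v x] assms by simp
  then obtain y where y: "(v, y) \<in> E ^^ n" "(y, x) \<in> E"
    by auto
  then have "d v y \<le> n" "d v x \<le> d v y + 1"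
    using dist_le dist_edge_le assms by auto
  then show ?thesis
    using y n edge_sym by (intro exI[of _ y]) auto
qed

text \<open>
  Follow geodesics from \<open>p\<close> and from \<open>q\<close> back towards \<open>v\<close> until they meet.  Closing the path up from
  outside, by an edge or through a vertex further away from \<open>v\<close>, would yield a circuit: this turns
  acyclicity into statements about distances.
\<close>

lemma ex_path_inside_ball:
  assumes "v \<in> V" "p \<in> V" "q \<in> V" "p \<noteq> q" "d v p = n" "d v q = n"
  shows "\<exists>xs. 3 \<le> length xs \<and> distinct xs \<and> successively (\<lambda>x y. (x, y) \<in> E) xs \<and>
              hd xs = p \<and> last xs = q \<and> (\<forall>x\<in>set xs. d v x \<le> n)"
  using assms(2-)
proof (induction n arbitrary: p q)
  case 0
  then show ?case using dist_eq_0 assms(1) by metis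
next
  case (Suc n)
  have "p \<noteq> v" "q \<noteq> v" using Suc.prems by auto
  then obtain p' q' where p': "(p, p') \<in> E" "d v p' = n" and q': "(q, q') \<in> E" "d v q' = n"
    using ex_closer_neighbour[of v p] ex_closer_neighbour[of v q] Suc.prems assms(1) by auto
  show ?case
  proof (cases "p' = q'")
    case True
    have "p \<noteq> p'" "q \<noteq> p'" using p' q' Suc.prems by auto
    then show ?thesis
      using p' q' Suc.prems True edge_sym by (intro exI[of _ "[p, p', q]"]) auto
  next
    case False
    then obtain xs where xs: "3 \<le> length xs" "distinct xs" "successively (\<lambda>x y. (x, y) \<in> E) xs"
      "hd xs = p'" "last xs = q'" "\<forall>x\<in>set xs. d v x \<le> n"
      using Suc.IH[of p' q'] p' q' edge_in_V by blast
    have "xs \<noteq> []" using xs(1) by auto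
    moreover have "p \<notin> set xs" "q \<notin> set xs" using xs(6) Suc.prems by fastforce+
    ultimately show ?thesis
      using xs p' q' Suc.prems edge_sym
      by (intro exI[of _ "p # xs @ [q]"]) (auto simp: successively_Cons successively_append_iff)
  qed
qed

lemma dist_edge_neq:
  assumes "v \<in> V" "(x, y) \<in> E"
  shows "d v x \<noteq> d v y"
proof
  assume eq: "d v x = d v y"
  have "x \<in> V" "y \<in> V" "x \<noteq> y" using edge_in_V edge_irrefl assms by auto
  then obtain xs where "3 \<le> length xs" "distinct xs" "successively (\<lambda>x y. (x, y) \<in> E) xs"
      "hd xs = x" "last xs = y"
    using ex_path_inside_ball[of v x y "d v y"] eq assms(1) by blast
  then show False
    using no_circuit[of xs] edge_sym[OF assms(2)] by (auto simp: circuit_def)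
qed

text \<open>
  Only one neighbour of a vertex is closer to \<open>v\<close>, so a path without backtracking that has begun to move away from
  \<open>v\<close> keeps moving away.  All metric properties of axes below come from this.
\<close>

lemma non_backtracking:
  assumes "v \<in> V" "(x, y) \<in> E" "(y, z) \<in> E" "x \<noteq> z" "d v y = d v x + 1"
  shows "d v z = d v y + 1"
proof (rule ccontr)
  assume "d v z \<noteq> d v y + 1"
  then have eq: "d v z = d v x"
    using dist_edge_neq[of v y z] dist_edge_le[of v y z] dist_edge_le[of v z y] assms edge_sym[OF assms(3)]
    by linarith
  have "x \<in> V" "z \<in> V" using edge_in_V assms by auto
  then obtain xs where xs: "3 \<le> length xs" "distinct xs" "successively (\<lambda>x y. (x, y) \<in> E) xs"
      "hd xs = x" "last xs = z" "\<forall>u\<in>set xs. d v u \<le> d v x"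
    using ex_path_inside_ball[of v x z "d v x"] eq assms(1,4) by metis
  have "y \<notin> set xs" "xs \<noteq> []" using xs(1,6) assms(5) by fastforce+
  then have "circuit E (y # xs)"
    using xs edge_sym[OF assms(2)] edge_sym[OF assms(3)]
    by (auto simp: circuit_def successively_Cons)
  then show False
    using no_circuit by blast
qed

text \<open>
  The step from \<open>y'\<close> to \<open>y\<close> moves away from \<open>v\<close> and towards \<open>w\<close>; continuing along a geodesic
  to \<open>w\<close> never backtracks.
\<close>

lemma dist_through:
  assumes "v \<in> V" "w \<in> V" "(y, y') \<in> E" "d v y = d v y' + 1" "d w y' = d w y + 1"
  shows "d v w = d v y + d y w"
  using assms(3-)
proof (induction "d w y" arbitrary: y y')
  case 0
  then show ?case using dist_eq_0[of w y] edge_in_V[of y y'] assms(2) by auto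
next
  case (Suc n)
  have "y \<in> V" "y \<noteq> w" using Suc edge_in_V by auto
  then obtain u where u: "(y, u) \<in> E" "d w y = d w u + 1"
    using ex_closer_neighbour[of w y] assms(2) by auto
  have "d v u = d v y + 1"
    using Suc.prems u edge_sym assms(1) by (intro non_backtracking[of v y' y u]) auto
  then have "d v w = d v u + d u w"
    using Suc.hyps u edge_sym by (intro Suc.hyps(1)[of u y]) auto
  then show ?case
    using u \<open>d v u = d v y + 1\<close> dist_sym[of w y] dist_sym[of w u] by simp
qed

lemma bi_infinite_path_in_V: "bi_infinite_path E c \<Longrightarrow> c k \<in> V"
  using edge_in_V by (auto simp: bi_infinite_path_def)

lemma dist_ray:
  assumes c: "bi_infinite_path E c" and v: "v \<in> V"
    and min: "\<And>j. d v (c k) \<le> d v (c j)"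
  shows "d v (c (k + int n)) = d v (c k) + n"
proof -
  have edge: "(c i, c (i + 1)) \<in> E" for i
    using c by (simp add: bi_infinite_path_def)
  have inj: "c i = c j \<longleftrightarrow> i = j" for i j
    using c by (auto simp: bi_infinite_path_def inj_def)
  have step: "d v (c (k + int n + 1)) = d v (c (k + int n)) + 1" for n
  proof (induction n)
    case 0
    show ?case
      using dist_edge_neq[OF v edge[of k]] dist_edge_le[OF v edge[of k]] min[of "k + 1"] by simp
  next
    case (Suc n)
    then show ?case
      using non_backtracking[OF v edge[of "k + int n"] edge[of "k + int n + 1"]] inj
      by (simp add: add_ac)
  qed
  show ?thesis
    by (induction n) (use step in \<open>auto simp: add_ac\<close>)
qed

definition foot :: "(int \<Rightarrow> 'v) \<Rightarrow> 'v \<Rightarrow> int" where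
  "foot c v = (SOME k. \<forall>j. d v (c k) \<le> d v (c j))"

lemma foot_minimal: "d v (c (foot c v)) \<le> d v (c j)"
proof -
  have "\<exists>k. \<forall>j. d v (c k) \<le> d v (c j)"
    using ex_has_least_nat[of "\<lambda>_. True" 0 "\<lambda>k. d v (c k)"] by auto
  then show ?thesis
    unfolding foot_def by (rule someI2_ex) auto
qed

text \<open>
  This formula is the tree property of bi-infinite paths in metric form: distances to \<open>c\<close> grow
  at unit speed on both sides of the foot.  In particular the foot is unique.
\<close>

lemma dist_foot:
  assumes c: "bi_infinite_path E c" and v: "v \<in> V"
  shows "int (d v (c j)) = int (d v (c (foot c v))) + \<bar>j - foot c v\<bar>"
proof (cases "foot c v \<le> j")
  case True
  then show ?thesis
    using dist_ray[OF c v foot_minimal, where n = "nat (j - foot c v)"] by simp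
next
  case False
  have "(c (- i - 1), c (- i - 1 + 1)) \<in> E" for i
    using c unfolding bi_infinite_path_def by blast
  then have "(c (- i), c (- (i + 1))) \<in> E" for i
    using edge_sym[of "c (- i - 1)" "c (- i)"] by (metis diff_add_cancel minus_add_distrib uminus_add_conv_diff add.commute)
  moreover have "inj (\<lambda>i. c (- i))"
    using c by (intro injI) (auto simp: bi_infinite_path_def dest: injD)
  ultimately have c': "bi_infinite_path E (\<lambda>i. c (- i))"
    by (simp add: bi_infinite_path_def)
  show ?thesis
    using dist_ray[OF c' v, of "- foot c v" "nat (foot c v - j)"] False foot_minimal[of v c] by simp
qed

lemma foot_unique:
  assumes "bi_infinite_path E c" "v \<in> V" "d v (c k) \<le> d v (c (foot c v))"
  shows "foot c v = k"
  using dist_foot[OF assms(1,2), of k] assms(3) by simp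

lemma foot_on_path:
  assumes c: "bi_infinite_path E c"
  shows "foot c (c k) = k"
  by (rule foot_unique[OF c bi_infinite_path_in_V[OF c]]) simp

lemma dist_on_path:
  assumes c: "bi_infinite_path E c"
  shows "int (d (c i) (c j)) = \<bar>i - j\<bar>"
  using dist_foot[OF c bi_infinite_path_in_V[OF c], of i j] foot_on_path[OF c, of i]
  by simp

text \<open>
  Two vertices with different feet on \<open>c\<close> are joined by a geodesic that runs along \<open>c\<close>: the last
  edge of \<open>c\<close> before the foot of \<open>w\<close> leads away from \<open>v\<close> and towards \<open>w\<close>.
\<close>

lemma dist_through_feet:
  assumes c: "bi_infinite_path E c" and v: "v \<in> V" and w: "w \<in> V"
    and neq: "foot c v \<noteq> foot c w"
  shows "int (d v w) = int (d v (c (foot c v))) + \<bar>foot c v - foot c w\<bar> + int (d (c (foot c w)) w)"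
proof -
  define k where "k = foot c w"
  define k' where "k' = (if foot c v < k then k - 1 else k + 1)"
  have "(c i, c (i + 1)) \<in> E" for i
    using c by (simp add: bi_infinite_path_def)
  from this[of k] this[of "k - 1"] have "(c k, c k') \<in> E"
    using edge_sym by (auto simp: k'_def)
  moreover have "d v (c k) = d v (c k') + 1"
    using dist_foot[OF c v, of k] dist_foot[OF c v, of k'] neq by (simp add: k'_def k_def split: if_splits)
  moreover have "d w (c k') = d w (c k) + 1"
    using dist_foot[OF c w, of k'] by (simp add: k'_def k_def split: if_splits)
  ultimately have "d v w = d v (c k) + d (c k) w"
    using dist_through v w by blast
  then show ?thesis
    using dist_foot[OF c v, of k] by (simp add: k_def)
qed

lemma foot_isometry:
  assumes c: "bi_infinite_path E c" and v: "v \<in> V" and gv: "g v \<in> V"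
    and isom: "\<And>j. d (g v) (g (c j)) = d v (c j)"
    and axis: "\<And>k. g (c k) = c (k + l)"
  shows "foot c (g v) = foot c v + l"
proof (rule foot_unique[OF c gv])
  have "d (g v) (c (foot c v + l)) = d v (c (foot c v))"
    using isom axis by metis
  also have "\<dots> \<le> d v (c (foot c (g v) - l))"
    by (rule foot_minimal)
  also have "\<dots> = d (g v) (c (foot c (g v)))"
    using isom axis by (metis diff_add_cancel)
  finally show "d (g v) (c (foot c v + l)) \<le> d (g v) (c (foot c (g v)))" .
qed

lemma set_path_dist_le: "x \<in> A \<Longrightarrow> y \<in> B \<Longrightarrow> set_path_dist E A B \<le> d x y"
  unfolding set_path_dist_def by (rule Least_le) auto

lemma ex_set_path_dist:
  assumes "A \<noteq> {}" "B \<noteq> {}"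
  shows "\<exists>x\<in>A. \<exists>y\<in>B. d x y = set_path_dist E A B"
proof -
  obtain a b where "a \<in> A" "b \<in> B"
    using assms by auto
  then have "\<exists>x\<in>A. \<exists>y\<in>B. d a b = d x y"
    by auto
  then have "\<exists>x\<in>A. \<exists>y\<in>B. set_path_dist E A B = d x y"
    unfolding set_path_dist_def by (rule LeastI)
  then show ?thesis
    by (simp add: eq_commute)
qed

lemma axis_projectionI:
  assumes "x \<in> A" "y \<in> B" "\<And>x' y'. x' \<in> A \<Longrightarrow> y' \<in> B \<Longrightarrow> d x y \<le> d x' y'"
  shows "x \<in> axis_projection E A B" "y \<in> axis_projection E B A"
proof -
  have eq: "set_path_dist E A' B' = n"
    if "\<exists>x\<in>A'. \<exists>y\<in>B'. d x y = n" "\<And>x' y'. x' \<in> A' \<Longrightarrow> y' \<in> B' \<Longrightarrow> n \<le> d x' y'" for A' B' n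
    unfolding set_path_dist_def using that by (intro Least_equality) auto
  have "set_path_dist E A B = d x y" "set_path_dist E {x} B = d x y"
    using assms by (auto intro!: eq)
  moreover have "set_path_dist E B A = d x y" "set_path_dist E {y} A = d x y"
    using assms dist_sym by (auto intro!: eq) metis+
  ultimately show "x \<in> axis_projection E A B" "y \<in> axis_projection E B A"
    using assms by (auto simp: axis_projection_def)
qed

text \<open>
  Let \<open>c i0\<close> and \<open>c' j0\<close> realise the distance of the two paths, and let \<open>x\<close> be the vertex of
  \<open>c\<close> nearest to \<open>v\<close>.  The foot of \<open>v\<close> on \<open>c'\<close> is not \<open>j0\<close>, because \<open>c' j0\<close> lies in the
  projection.  If \<open>x\<close> has foot \<open>j0\<close> on \<open>c'\<close>, the geodesics from \<open>v\<close> to \<open>x\<close> and to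
  \<open>c i0\<close> share their part up to \<open>c' j0\<close>, and minimality of \<open>x\<close> shows that \<open>x\<close> is as
  close to \<open>c' j0\<close> as \<open>c i0\<close> is.  If \<open>x\<close> has another foot \<open>j\<close>, the geodesic from \<open>x\<close> to \<open>c i0\<close>, which lies in
  \<open>c\<close>, passes through \<open>c' j\<close>; the paths then meet in \<open>c' j\<close>, which is again in the projection and not
  the foot of \<open>v\<close>, so the geodesic from \<open>v\<close> to \<open>x\<close> passes through it and \<open>x = c' j\<close> by
  minimality.
\<close>

lemma foot_in_projection:
  assumes c: "bi_infinite_path E c" and c': "bi_infinite_path E c'" and v: "v \<in> V"
    and outside: "c' (foot c' v) \<notin> axis_projection E (range c') (range c)"
  shows "c (foot c v) \<in> axis_projection E (range c) (range c')"
proof -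
  define z where "z = c' (foot c' v)"
  define x where "x = c (foot c v)"
  obtain i0 j0 where D: "d (c i0) (c' j0) = set_path_dist E (range c) (range c')"
    using ex_set_path_dist[of "range c" "range c'"] by blast
  define D where "D = d (c i0) (c' j0)"
  have D_le: "D \<le> d (c i) (c' j)" for i j
    using set_path_dist_le[of "c i" "range c" "c' j" "range c'"] D by (simp add: D_def)
  note inV = bi_infinite_path_in_V[OF c] bi_infinite_path_in_V[OF c']
  have proj: "c i \<in> axis_projection E (range c) (range c')"
             "c' j \<in> axis_projection E (range c') (range c)"
    if "d (c i) (c' j) \<le> D" for i j
    using that D_le order_trans by (intro axis_projectionI[of "c i" _ "c' j"]; blast)+
  have j0: "foot c' (c i0) = j0"
    using foot_unique[OF c' inV(1)[of i0], of j0] D_le[of i0 "foot c' (c i0)"] by (simp add: D_def)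
  have ne: "foot c' v \<noteq> j0"
    using outside proj(2)[of i0 j0] by (auto simp: D_def)
  have x_le: "d v x \<le> d v (c i)" for i
    by (simp add: x_def foot_minimal)
  define j where "j = foot c' x"
  have xV: "x \<in> V" by (simp add: x_def inV)
  show ?thesis
  proof (cases "j = j0")
    case True
    have "d v x \<le> d v (c i0)" by (rule x_le)
    then have "d x (c' j0) \<le> D"
      using dist_through_feet[OF c' v xV] dist_through_feet[OF c' v inV(1)[of i0]] True ne j0
        dist_sym[of x "c' j0"] dist_sym[of "c i0" "c' j0"]
      by (simp add: j_def D_def)
    then show ?thesis
      using proj(1) by (simp add: x_def)
  next
    case False
    have "int (d x (c i0)) \<ge> int (d (c' j) x) + int (d (c' j) (c i0))"
      using dist_through_feet[OF c' xV inV(1)[of i0]] False j0 dist_foot[OF c' inV(1)[of i0], of j]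
        dist_sym[of x "c' j"] dist_sym[of "c i0" "c' j"] dist_sym[of "c i0" "c' j0"]
      by (simp add: j_def abs_minus_commute)
    then have "d (c' j) (c (foot c (c' j))) = 0"
      using dist_foot[OF c inV(2)[of j], of "foot c v"] dist_foot[OF c inV(2)[of j], of i0]
        dist_on_path[OF c, of "foot c v" i0]
      by (simp add: x_def)
    then have on_c: "c' j = c (foot c (c' j))"
      using dist_eq_0 inV by blast
    then have D0: "D = 0"
      using D_le[of "foot c (c' j)" j] by simp
    have "foot c' v \<noteq> j"
      using outside proj(2)[of "foot c (c' j)" j] on_c by auto
    then have "d v x = d v (c' j) + d (c' j) x"
      using dist_through_feet[OF c' v xV] dist_foot[OF c' v, of j]
      by (simp add: j_def abs_minus_commute)
    moreover have "d v x \<le> d v (c' j)"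
      using x_le on_c by metis
    ultimately have "d x (c' j) \<le> D"
      using dist_sym[of x "c' j"] by simp
    then show ?thesis
      using proj(1) by (simp add: x_def)
  qed
qed

text \<open>
  An open segment of length \<open>l\<close> need not be given by the same parametrisation \<open>c\<close> of the axis, and
  its end points need not be vertices.  Its vertices have mutual distances less than \<open>l\<close>,
  which is independent of the parametrisation, so they fit into \<open>l\<close> consecutive vertices
  of \<open>c\<close>: a fundamental domain for the translation by \<open>l\<close>.
\<close>

lemma open_segment_window:
  assumes P: "open_segment_in E (range c) l P" and c: "bi_infinite_path E c"
  shows "\<exists>m. \<forall>k. c k \<in> P \<longrightarrow> m \<le> k \<and> k < m + int l"
proof -
  obtain b a where b: "bi_infinite_path E b"
    and P: "P = {b k | k. a < real_of_int k \<and> real_of_int k < a + real l}"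
    using P by (auto simp: open_segment_in_def)
  have short: "\<bar>i - j\<bar> < int l" if P_ij: "c i \<in> P" "c j \<in> P" for i j
  proof -
    obtain i' j' where ij: "c i = b i'" "c j = b j'" "a < i'" "i' < a + l" "a < j'" "j' < a + l"
      using P_ij P by blast
    have "\<bar>i - j\<bar> = \<bar>i' - j'\<bar>"
      using dist_on_path[OF c, of i j] dist_on_path[OF b, of i' j'] ij by simp
    moreover have "real_of_int \<bar>i' - j'\<bar> < real_of_int (int l)"
      using ij by (simp add: abs_if)
    ultimately show ?thesis
      by (simp only: of_int_less_iff)
  qed
  define K where "K = {k. c k \<in> P}"
  show ?thesis
  proof (cases "K = {}")
    case False
    then obtain k0 where "k0 \<in> K" by blast
    then have "K \<subseteq> {k0 - int l..k0 + int l}"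
      using short by (force simp: K_def)
    then have "finite K"
      using finite_subset by blast
    then have "Min K \<in> K" "\<forall>k\<in>K. Min K \<le> k"
      using False by auto
    then show ?thesis
      using short[of _ "Min K"] by (intro exI[of _ "Min K"]) (force simp: K_def)
  qed (auto simp: K_def)
qed

section \<open>The isometry group of a tree\<close>

abbreviation "I \<equiv> Isom V E"

lemma carrier_Isom: "carrier I = tree_isometries V E"
  by (simp add: Isom_def)

lemma Isom_subgroup_BijGroup: "subgroup (tree_isometries V E) (BijGroup V)"
proof (rule group.subgroupI[OF group_BijGroup])
  show "tree_isometries V E \<subseteq> carrier (BijGroup V)"
    by (auto simp: tree_isometries_def BijGroup_def)
  show "tree_isometries V E \<noteq> {}"
    using id_Bij[of V] by (auto simp: tree_isometries_def)
next
  fix g h assume "g \<in> tree_isometries V E" "h \<in> tree_isometries V E"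
  then show "g \<otimes>\<^bsub>BijGroup V\<^esub> h \<in> tree_isometries V E"
    using Bij_imp_funcset[of h V]
    by (auto simp: tree_isometries_def BijGroup_def compose_Bij compose_def Pi_iff)
       (use compose_Bij[of g V h] in \<open>simp add: compose_def\<close>)
next
  fix g assume g: "g \<in> tree_isometries V E"
  then have bij: "g \<in> Bij V" "bij_betw g V V"
    by (auto simp: tree_isometries_def Bij_def)
  have "d (inv_into V g x) (inv_into V g y) = d x y" if "x \<in> V" "y \<in> V" for x y
    using g that bij bij_betw_inv_into_right[OF bij(2)] Bij_inv_into_mem[OF bij(1)]
    unfolding tree_isometries_def mem_Collect_eq by metis
  then show "inv\<^bsub>BijGroup V\<^esub> g \<in> tree_isometries V E"
    using bij by (simp add: inv_BijGroup tree_isometries_def restrict_inv_into_Bij)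
qed

lemma group_Isom: "group I"
  unfolding Isom_def by (rule group.subgroup_imp_group[OF group_BijGroup Isom_subgroup_BijGroup])

lemma one_Isom: "x \<in> V \<Longrightarrow> \<one>\<^bsub>I\<^esub> x = x"
  by (simp add: Isom_def BijGroup_def)

lemma isometry_extensional: "g \<in> carrier I \<Longrightarrow> g \<in> extensional V"
  by (simp add: carrier_Isom tree_isometries_def Bij_def)

lemma dist_isometry: "g \<in> carrier I \<Longrightarrow> x \<in> V \<Longrightarrow> y \<in> V \<Longrightarrow> d (g x) (g y) = d x y"
  by (simp add: carrier_Isom tree_isometries_def)

lemma action:
  assumes "subgroup H I"
  shows "group_action (I\<lparr>carrier := H\<rparr>) V (\<lambda>g. g)"
proof (intro group_action.intro group_hom.intro group_hom_axioms.intro)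
  show "group (I\<lparr>carrier := H\<rparr>)"
    by (rule group.subgroup_imp_group[OF group_Isom assms])
  have "H \<subseteq> carrier (BijGroup V)"
    using subgroup.subset[OF assms] subgroup.subset[OF Isom_subgroup_BijGroup] carrier_Isom by auto
  then show "(\<lambda>g. g) \<in> hom (I\<lparr>carrier := H\<rparr>) (BijGroup V)"
    by (auto simp: hom_def Isom_def)
qed (rule group_BijGroup)

lemma Isom_action: "group_action I V (\<lambda>g. g)"
  using action[OF group.subgroup_self[OF group_Isom]] by simp

lemma isometry_in_V: "g \<in> carrier I \<Longrightarrow> x \<in> V \<Longrightarrow> g x \<in> V"
  using group_action.element_image[OF Isom_action] by blast

text \<open>
  The minimum in the definition of the translation length is attained.
\<close>

lemma elliptic_iff:
  assumes "g \<in> carrier I"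
  shows "elliptic V E g \<longleftrightarrow> (\<exists>x\<in>V. g x = x)"
proof
  assume "elliptic V E g"
  then have "translation_length V E g = 0"
    by (simp add: elliptic_def)
  moreover obtain v where "v \<in> V"
    using tree by (auto simp: simplicial_tree_def)
  then have "\<exists>x\<in>V. d v (g v) = d x (g x)"
    by blast
  then have "\<exists>x\<in>V. translation_length V E g = d x (g x)"
    unfolding translation_length_def by (rule LeastI)
  ultimately obtain x where "x \<in> V" "d x (g x) = 0"
    by auto
  then show "\<exists>x\<in>V. g x = x"
    using dist_eq_0[of x "g x"] isometry_in_V[OF assms] by (intro bexI[of _ x]) auto
next
  assume "\<exists>x\<in>V. g x = x"
  then have "\<exists>x\<in>V. 0 = d x (g x)"
    by force
  then have "translation_length V E g \<le> 0"
    unfolding translation_length_def by (rule Least_le)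
  then show "elliptic V E g"
    by (simp add: elliptic_def)
qed

section \<open>Vertex stabilisers in discrete groups\<close>

lemma finite_ball:
  assumes fin: "\<forall>x\<in>V. finite {y. (x, y) \<in> E}" and v: "v \<in> V"
  shows "finite {x \<in> V. d v x \<le> n}"
proof (induction n)
  case 0
  have "{x \<in> V. d v x \<le> 0} \<subseteq> {v}"
    using dist_eq_0 v by auto
  then show ?case
    using finite_subset by blast
next
  case (Suc n)
  let ?B = "{x \<in> V. d v x \<le> n}"
  have "{x \<in> V. d v x \<le> Suc n} \<subseteq> {v} \<union> (\<Union>x\<in>?B. {y. (x, y) \<in> E})"
  proof
    fix x assume x: "x \<in> {x \<in> V. d v x \<le> Suc n}"
    show "x \<in> {v} \<union> (\<Union>x\<in>?B. {y. (x, y) \<in> E})"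
    proof (cases "x = v")
      case False
      then obtain y where "(x, y) \<in> E" "d v x = d v y + 1"
        using ex_closer_neighbour[OF v, of x] x by auto
      then have "y \<in> ?B" "(y, x) \<in> E"
        using x edge_sym edge_in_V by auto
      then show ?thesis by blast
    qed simp
  qed
  moreover have "finite ({v} \<union> (\<Union>x\<in>?B. {y. (x, y) \<in> E}))"
    using Suc fin by simp
  ultimately show ?case
    by (rule finite_subset)
qed

text \<open>
  A basic neighbourhood of the identity for pointwise convergence constrains only finitely many
  vertices.
\<close>

lemma discrete_subgroup_separated:
  assumes "discrete_subgroup V E \<Gamma>"
  shows "\<exists>F. finite F \<and> F \<subseteq> V \<and> (\<forall>g\<in>\<Gamma>. (\<forall>x\<in>F. g x = x) \<longrightarrow> g = \<one>\<^bsub>I\<^esub>)"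
proof -
  have \<Gamma>: "subgroup \<Gamma> I" and disc: "subtopology (Isom_topology V E) \<Gamma> = discrete_topology \<Gamma>"
    using assms by (auto simp: discrete_subgroup_def)
  have "openin (subtopology (Isom_topology V E) \<Gamma>) {\<one>\<^bsub>I\<^esub>}"
    using subgroup.one_closed[OF \<Gamma>] by (simp add: disc)
  then obtain W where W: "openin (product_topology (\<lambda>_. discrete_topology V) V) W"
    and eq: "{\<one>\<^bsub>I\<^esub>} = W \<inter> carrier I \<inter> \<Gamma>"
    unfolding Isom_topology_def openin_subtopology by auto
  have "\<one>\<^bsub>I\<^esub> \<in> W"
    using eq by blast
  then obtain U where U: "finite {i \<in> V. U i \<noteq> V}" "\<one>\<^bsub>I\<^esub> \<in> Pi\<^sub>E V U" "Pi\<^sub>E V U \<subseteq> W"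
    using W unfolding openin_product_topology_alt by auto
  have "g = \<one>\<^bsub>I\<^esub>" if g: "g \<in> \<Gamma>" and fixed: "\<forall>x\<in>{i \<in> V. U i \<noteq> V}. g x = x" for g
  proof -
    have gI: "g \<in> carrier I"
      using g subgroup.subset[OF \<Gamma>] by blast
    have "g x \<in> U x" if x: "x \<in> V" for x
    proof (cases "U x = V")
      case True
      then show ?thesis using isometry_in_V[OF gI x] by simp
    next
      case False
      then have "g x = \<one>\<^bsub>I\<^esub> x" using fixed x one_Isom by simp
      then show ?thesis using U(2) x by auto
    qed
    then have "g \<in> W"
      using U(3) isometry_extensional[OF gI] by (auto simp: PiE_def)
    then show ?thesis
      using eq g gI by blast
  qed
  then show ?thesis
    using U(1) by (intro exI[of _ "{i \<in> V. U i \<noteq> V}"]) auto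
qed

text \<open>
  An element of a discrete group is determined by its values on some finite set \<open>F\<close> of vertices, and an element
  fixing \<open>x\<close> maps each vertex of \<open>F\<close> into a finite ball around \<open>x\<close>.
\<close>

lemma finite_stabilizer:
  assumes fin: "\<forall>x\<in>V. finite {y. (x, y) \<in> E}"
    and disc: "discrete_subgroup V E \<Gamma>" and x: "x \<in> V"
  shows "finite (\<Gamma> \<inter> stabilizer I (\<lambda>g. g) x)"
proof -
  interpret I: group I by (rule group_Isom)
  interpret act: group_action I V "\<lambda>g. g" by (rule Isom_action)
  have \<Gamma>: "subgroup \<Gamma> I"
    using disc by (simp add: discrete_subgroup_def)
  from discrete_subgroup_separated[OF disc] obtain F where F: "finite F" "F \<subseteq> V"
    "\<forall>g\<in>\<Gamma>. (\<forall>y\<in>F. g y = y) \<longrightarrow> g = \<one>\<^bsub>I\<^esub>"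
    by (elim exE conjE)
  let ?S = "\<Gamma> \<inter> stabilizer I (\<lambda>g. g) x"
  have carr: "g \<in> carrier I" if "g \<in> \<Gamma>" for g
    using subgroup.subset[OF \<Gamma>] that by blast
  have inj: "g = h" if g: "g \<in> \<Gamma>" and h: "h \<in> \<Gamma>" and eq: "\<And>y. y \<in> F \<Longrightarrow> g y = h y" for g h
  proof -
    have "inv\<^bsub>I\<^esub> h \<otimes>\<^bsub>I\<^esub> g = \<one>\<^bsub>I\<^esub>"
    proof (intro F(3)[rule_format])
      show "inv\<^bsub>I\<^esub> h \<otimes>\<^bsub>I\<^esub> g \<in> \<Gamma>"
        using g h \<Gamma> by (simp add: subgroup.m_closed subgroup.m_inv_closed)
      fix y assume y: "y \<in> F"
      then have yV: "y \<in> V" using F(2) by blast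
      have "(inv\<^bsub>I\<^esub> h \<otimes>\<^bsub>I\<^esub> g) y = (inv\<^bsub>I\<^esub> h) (h y)"
        using act.composition_rule[OF yV, of "inv\<^bsub>I\<^esub> h" g] carr g h eq[OF y] by simp
      also have "\<dots> = (inv\<^bsub>I\<^esub> h \<otimes>\<^bsub>I\<^esub> h) y"
        using act.composition_rule[OF yV, of "inv\<^bsub>I\<^esub> h" h] carr h by simp
      finally show "(inv\<^bsub>I\<^esub> h \<otimes>\<^bsub>I\<^esub> g) y = y"
        using carr[OF h] one_Isom[OF yV] by simp
    qed
    then show ?thesis
      using carr[OF g] carr[OF h] by (metis I.inv_equality I.inv_inv I.inv_closed)
  qed
  have inj_S: "inj_on (\<lambda>g. restrict g F) ?S"
  proof (rule inj_onI)
    fix g h assume g: "g \<in> ?S" and h: "h \<in> ?S" and eq: "restrict g F = restrict h F"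
    have "g y = h y" if "y \<in> F" for y
      using fun_cong[OF eq, of y] that by simp
    then show "g = h"
      using inj g h by simp
  qed
  have "(\<lambda>g. restrict g F) ` ?S \<subseteq> (\<Pi>\<^sub>E y\<in>F. {z \<in> V. d x z \<le> d x y})"
  proof -
    have "g y \<in> V \<and> d x (g y) \<le> d x y" if g: "g \<in> ?S" and y: "y \<in> F" for g y
    proof -
      have "g \<in> carrier I" "g x = x" "y \<in> V"
        using g y F(2) by (auto simp: stabilizer_def)
      then show ?thesis
        using dist_isometry[of g x y] isometry_in_V[of g y] x by simp
    qed
    then show ?thesis by auto
  qed
  moreover have "finite (\<Pi>\<^sub>E y\<in>F. {z \<in> V. d x z \<le> d x y})"
    using F(1) finite_ball[OF fin x] by (intro finite_PiE) auto
  ultimately have "finite ((\<lambda>g. restrict g F) ` ?S)"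
    by (rule finite_subset)
  then show ?thesis
    using inj_S by (rule finite_imageD)
qed

section \<open>Ping pong on the axes\<close>

text \<open>
  The letter \<open>s\<close> owns the vertices whose foot on the axis of \<open>s\<close> is beyond the chosen segment, its inverse
  those whose foot is before it.
\<close>

lemma ping_pong_tuple_free:
  assumes H: "subgroup H I" and gen: "generate I (X ` {1..n}) = H"
    and carr: "X ` {1..n} \<subseteq> carrier I"
    and pp: "ping_pong_hypotheses V E n X"
  shows "free_basis (I\<lparr>carrier := H\<rparr>) (X ` {1..n})"
proof -
  interpret I: group I by (rule group_Isom)
  interpret act: group_action "I\<lparr>carrier := H\<rparr>" V "\<lambda>g. g" by (rule action[OF H])
  let ?l = "\<lambda>i. translation_length V E (X i)"
  have "\<exists>c m. bi_infinite_path E c \<and> (\<forall>k. X i (c k) = c (k + int (?l i))) \<and> \<gamma> i = range c \<and>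
              (\<forall>j\<in>{1..n} - {i}. \<forall>k. c k \<in> axis_projection E (\<gamma> i) (\<gamma> j) \<longrightarrow> m \<le> k \<and> k < m + int (?l i))"
    if i: "i \<in> {1..n}" and axes: "\<forall>i\<in>{1..n}. is_axis V E (X i) (\<gamma> i)"
      and segs: "\<forall>i\<in>{1..n}. \<exists>P. open_segment_in E (\<gamma> i) (?l i) P \<and>
        (\<Union>j\<in>{1..n} - {i}. axis_projection E (\<gamma> i) (\<gamma> j)) \<subseteq> P" for i \<gamma>
  proof -
    obtain c where c: "bi_infinite_path E c" "\<gamma> i = range c" "\<forall>k. X i (c k) = c (k + int (?l i))"
      using axes i unfolding is_axis_def by blast
    obtain P where P: "open_segment_in E (\<gamma> i) (?l i) P"
      "(\<Union>j\<in>{1..n} - {i}. axis_projection E (\<gamma> i) (\<gamma> j)) \<subseteq> P"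
      using segs i by blast
    obtain m where m: "\<forall>k. c k \<in> P \<longrightarrow> m \<le> k \<and> k < m + int (?l i)"
      using open_segment_window[OF P(1)[unfolded c(2)] c(1)] by blast
    show ?thesis
      using c m P(2) by (intro exI[of _ c] exI[of _ m]) blast
  qed
  moreover obtain \<gamma> where "\<forall>i\<in>{1..n}. is_axis V E (X i) (\<gamma> i)"
    "\<forall>i\<in>{1..n}. \<exists>P. open_segment_in E (\<gamma> i) (?l i) P \<and>
        (\<Union>j\<in>{1..n} - {i}. axis_projection E (\<gamma> i) (\<gamma> j)) \<subseteq> P"
    using pp by (auto simp: ping_pong_hypotheses_def)
  ultimately have "\<forall>i\<in>{1..n}. \<exists>c m. bi_infinite_path E c \<and> (\<forall>k. X i (c k) = c (k + int (?l i))) \<and> \<gamma> i = range c \<and>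
              (\<forall>j\<in>{1..n} - {i}. \<forall>k. c k \<in> axis_projection E (\<gamma> i) (\<gamma> j) \<longrightarrow> m \<le> k \<and> k < m + int (?l i))"
    by blast
  then obtain c m where cm: "\<forall>i\<in>{1..n}. bi_infinite_path E (c i) \<and>
      (\<forall>k. X i (c i k) = c i (k + int (?l i))) \<and> \<gamma> i = range (c i) \<and>
      (\<forall>j\<in>{1..n} - {i}. \<forall>k. c i k \<in> axis_projection E (\<gamma> i) (\<gamma> j) \<longrightarrow> m i \<le> k \<and> k < m i + int (?l i))"
    by metis
  have path: "bi_infinite_path E (c i)" and shift: "X i (c i k) = c i (k + int (?l i))"
    if "i \<in> {1..n}" for i k
    using cm that by blast+
  have window: "m i \<le> k \<and> k < m i + int (?l i)"
    if "i \<in> {1..n}" "j \<in> {1..n}" "i \<noteq> j" "c i k \<in> axis_projection E (range (c i)) (range (c j))" for i j k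
    using cm that by (metis DiffI singletonD)
  have len_pos: "?l i > 0" if "i \<in> {1..n}" for i
    using pp that by (simp add: ping_pong_hypotheses_def hyperbolic_def)

  \<comment> \<open>Letters are elements of the group, so each one is assigned an index of the tuple; distinct letters get
    distinct indices even if the tuple has repetitions.\<close>
  define idx where "idx s = (SOME i. i \<in> {1..n} \<and> X i = s)" for s
  have idx: "idx s \<in> {1..n}" "X (idx s) = s" if "s \<in> X ` {1..n}" for s
  proof -
    have "\<exists>i. i \<in> {1..n} \<and> X i = s" using that by auto
    then have "idx s \<in> {1..n} \<and> X (idx s) = s" unfolding idx_def by (rule someI_ex)
    then show "idx s \<in> {1..n}" "X (idx s) = s" by auto
  qed
  \<comment> \<open>Feet are measured from the first vertex of the window, so that the window becomes
    \<open>{0..<l s}\<close>.\<close>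
  define pos where "pos s v = foot (c (idx s)) v - m (idx s)" for s v
  define l where "l s = int (translation_length V E s)" for s
  have l_pos: "l s > 0" if "s \<in> X ` {1..n}" for s
    using len_pos[OF idx(1)[OF that]] idx(2)[OF that] by (simp add: l_def)
  have pos_shift: "pos s (s v) = pos s v + l s" if s: "s \<in> X ` {1..n}" and v: "v \<in> V" for s v
  proof -
    have sI: "s \<in> carrier I" using s carr by blast
    have "foot (c (idx s)) (s v) = foot (c (idx s)) v + l s"
    proof (rule foot_isometry[where g = s, OF path[OF idx(1)[OF s]] v isometry_in_V[OF sI v]])
      show "d (s v) (s (c (idx s) j)) = d v (c (idx s) j)" for j
        by (rule dist_isometry[OF sI v bi_infinite_path_in_V[OF path[OF idx(1)[OF s]]]])
      show "s (c (idx s) k) = c (idx s) (k + l s)" for k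
        using shift[OF idx(1)[OF s]] idx(2)[OF s] by (simp add: l_def)
    qed
    then show ?thesis by (simp add: pos_def)
  qed
  \<comment> \<open>The sets of different letters are disjoint.\<close>
  have one_outside: "0 \<le> pos t v \<and> pos t v < l t"
    if s: "s \<in> X ` {1..n}" and t: "t \<in> X ` {1..n}" and ne: "s \<noteq> t" and v: "v \<in> V"
      and out: "\<not> (0 \<le> pos s v \<and> pos s v < l s)" for s t v
  proof -
    have ne': "idx s \<noteq> idx t" using idx(2) s t ne by metis
    have "c (idx s) (foot (c (idx s)) v) \<notin> axis_projection E (range (c (idx s))) (range (c (idx t)))"
      using window[OF idx(1)[OF s] idx(1)[OF t] ne'] out idx(2)[OF s]
      by (force simp: pos_def l_def)
    then have "c (idx t) (foot (c (idx t)) v) \<in> axis_projection E (range (c (idx t))) (range (c (idx s)))"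
      using foot_in_projection[OF path[OF idx(1)[OF t]] path[OF idx(1)[OF s]] v] by blast
    then show ?thesis
      using window[OF idx(1)[OF t] idx(1)[OF s] ne'[symmetric]] idx(2)[OF t]
      by (force simp: pos_def l_def)
  qed
  have subH: "X ` {1..n} \<subseteq> H"
    using generate.incl[of _ "X ` {1..n}" I] gen by blast
  have inv_eq: "inv\<^bsub>I\<lparr>carrier := H\<rparr>\<^esub> s = inv\<^bsub>I\<^esub> s" if "s \<in> X ` {1..n}" for s
    using I.m_inv_consistent[OF H] subH that by blast
  have inv_act: "(inv\<^bsub>I\<^esub> s) v \<in> V" "s ((inv\<^bsub>I\<^esub> s) v) = v" if s: "s \<in> X ` {1..n}" and v: "v \<in> V" for s v
  proof -
    have sI: "s \<in> carrier I" using s carr by blast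
    show "(inv\<^bsub>I\<^esub> s) v \<in> V"
      using isometry_in_V[OF I.inv_closed[OF sI] v] .
    show "s ((inv\<^bsub>I\<^esub> s) v) = v"
      using group_action.composition_rule[OF Isom_action v sI I.inv_closed[OF sI]] sI one_Isom[OF v]
      by simp
  qed
  define A where "A s b = (if b then {v \<in> V. l s \<le> pos s v} else {v \<in> V. pos s v < 0})" for s b
  show ?thesis
  proof (rule act.ping_pong[where A = A])
    show "X ` {1..n} \<subseteq> carrier (I\<lparr>carrier := H\<rparr>)"
      using subH by simp
    show "generate (I\<lparr>carrier := H\<rparr>) (X ` {1..n}) = carrier (I\<lparr>carrier := H\<rparr>)"
      using I.generate_consistent[OF subH H] gen by simp
  next
    fix s v assume s: "s \<in> X ` {1..n}" and v: "v \<in> V - A s False"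
    have "s v \<in> V"
      using isometry_in_V s carr v by blast
    then show "s v \<in> A s True"
      using pos_shift[OF s] v by (auto simp: A_def)
  next
    fix s v assume s: "s \<in> X ` {1..n}" and v: "v \<in> V - A s True"
    then show "(inv\<^bsub>I\<lparr>carrier := H\<rparr>\<^esub> s) v \<in> A s False"
      using inv_act[OF s, of v] pos_shift[OF s, of "(inv\<^bsub>I\<^esub> s) v"] inv_eq[OF s] by (auto simp: A_def)
  next
    fix s assume s: "s \<in> X ` {1..n}"
    show "A s True \<inter> A s False = {}"
      using l_pos[OF s] by (auto simp: A_def)
    \<comment> \<open>The first vertex of the window is its own foot, and the window is non-empty because \<open>s\<close> is
      hyperbolic.\<close>
    define v where "v = c (idx s) (m (idx s))"
    have "v \<in> V" "pos s v = 0"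
      using bi_infinite_path_in_V[OF path[OF idx(1)[OF s]]] foot_on_path[OF path[OF idx(1)[OF s]]]
      by (auto simp: v_def pos_def)
    then have "v \<in> V - A s True - A s False"
      using l_pos[OF s] by (simp add: A_def)
    then show "V - A s True - A s False \<noteq> {}"
      by blast
  next
    fix s t b b' assume s: "s \<in> X ` {1..n}" and t: "t \<in> X ` {1..n}" and ne: "s \<noteq> t"
    have out: "v \<in> V \<and> \<not> (0 \<le> pos s v \<and> pos s v < l s)" if "v \<in> A s b" "s \<in> X ` {1..n}" for v s b
      using that l_pos[of s] by (auto simp: A_def split: if_splits)
    show "A s b \<inter> A t b' = {}"
      using out[OF _ s] out[OF _ t] one_outside[OF s t ne] by blast
  qed
qed

end

section \<open>Minimal generating tuples\<close>

text \<open>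
  The move is undone by multiplying with the inverse of the unchanged entry.
\<close>

lemma (in group) generate_tuple_move:
  assumes X: "X ` {1..n} \<subseteq> carrier G" and j: "j \<in> {1..n}"
  shows "generate G (tuple_move G X j S1 S2 ` {1..n}) = generate G (X ` {1..n})"
proof -
  let ?Y = "tuple_move G X j S1 S2"
  have cX: "X i \<in> carrier G" if "i \<in> {1..n}" for i using X that by blast
  note clo = generate.eng generate_m_inv_closed
  have "?Y i \<in> carrier G" if i: "i \<in> {1..n}" for i
    using cX[OF i] cX[OF j] by (simp add: tuple_move_def)
  then have cY: "?Y ` {1..n} \<subseteq> carrier G"
    by (rule image_subsetI)
  have "?Y i \<in> generate G (X ` {1..n})" if i: "i \<in> {1..n}" for i
  proof -
    have "X i \<in> generate G (X ` {1..n})" "X j \<in> generate G (X ` {1..n})"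
      by (intro generate.incl imageI i j)+
    then show ?thesis
      using X by (simp add: tuple_move_def clo)
  qed
  then have "generate G (?Y ` {1..n}) \<subseteq> generate G (X ` {1..n})"
    using generate_is_subgroup[OF X] by (intro generate_subgroup_incl) auto
  moreover have "X i \<in> generate G (?Y ` {1..n})" if i: "i \<in> {1..n}" for i
  proof -
    have gi: "?Y i \<in> generate G (?Y ` {1..n})" "?Y j \<in> generate G (?Y ` {1..n})"
      by (intro generate.incl imageI i j)+
    then have gj: "X j \<in> generate G (?Y ` {1..n})"
      by (simp add: tuple_move_def)
    have "X i = ?Y i \<or> X i = inv (X j) \<otimes> ?Y i \<or> X i = ?Y i \<otimes> X j \<or> X i = inv (X j) \<otimes> ?Y i \<otimes> X j"
      using cX[OF i] cX[OF j] by (simp add: tuple_move_def m_assoc) (simp flip: m_assoc)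
    then show ?thesis
      using gi gj cY by (elim disjE) (simp_all add: clo)
  qed
  then have "generate G (X ` {1..n}) \<subseteq> generate G (?Y ` {1..n})"
    using generate_is_subgroup[OF cY] by (intro generate_subgroup_incl) auto
  ultimately show ?thesis by blast
qed

lemma (in group) generate_delete_one:
  assumes "B \<subseteq> carrier G"
  shows "generate G (B - {\<one>}) = generate G B"
proof
  show "generate G (B - {\<one>}) \<subseteq> generate G B"
    by (rule mono_generate) auto
  have "B \<subseteq> generate G (B - {\<one>})"
    using generate.incl[of _ "B - {\<one>}" G] generate.one[of G] by blast
  then show "generate G B \<subseteq> generate G (B - {\<one>})"
    using assms generate_is_subgroup[of "B - {\<one>}"] by (intro generate_subgroup_incl) auto
qed

text \<open>
  Total length takes values in the natural numbers, so it has a least value on all \<open>n\<close>-tuples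
  generating the given group, and by \<open>generate_tuple_move\<close> the competitors in the definition of a
  minimal tuple are among these.
\<close>

lemma (in tree) ex_minimal_tuple:
  assumes "X0 ` {1..n} \<subseteq> carrier I"
  shows "\<exists>X. X ` {1..n} \<subseteq> carrier I \<and> generate I (X ` {1..n}) = generate I (X0 ` {1..n}) \<and>
             minimal_tuple V E n X"
proof -
  interpret I: group I by (rule group_Isom)
  let ?P = "\<lambda>X. X ` {1..n} \<subseteq> carrier I \<and> generate I (X ` {1..n}) = generate I (X0 ` {1..n})"
  obtain X where X: "?P X" and least: "\<And>Y. ?P Y \<Longrightarrow> tuple_length V E n X \<le> tuple_length V E n Y"
    using ex_has_least_nat[of ?P X0 "tuple_length V E n"] assms by blast
  have "tuple_length V E n X \<le> tuple_length V E n (tuple_move I X j S1 S2)" if j: "j \<in> {1..n}" for j S1 S2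
  proof (rule least)
    have cX: "X i \<in> carrier I" if "i \<in> {1..n}" for i using X that by blast
    have "tuple_move I X j S1 S2 i \<in> carrier I" if i: "i \<in> {1..n}" for i
      using cX[OF i] cX[OF j] by (simp add: tuple_move_def)
    then have "tuple_move I X j S1 S2 ` {1..n} \<subseteq> carrier I"
      by (rule image_subsetI)
    then show "?P (tuple_move I X j S1 S2)"
      using I.generate_tuple_move[of X n j S1 S2] X j by simp
  qed
  then have "minimal_tuple V E n X"
    by (simp add: minimal_tuple_def)
  then show ?thesis
    using X by (intro exI[of _ X]) simp
qed

text \<open>
  Taking the generating set of least cardinality rules out an elliptic entry, which would be
  the identity.
\<close>

lemma (in tree) finitely_generated_free:
  assumes PP: "conjecture_PP TYPE('v)"
    and A: "finite A" "A \<subseteq> carrier I"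
    and no_inv: "without_inversions E (generate I A)"
    and no_ell: "\<And>g. g \<in> generate I A \<Longrightarrow> elliptic V E g \<Longrightarrow> g = \<one>\<^bsub>I\<^esub>"
  shows "free_group (I\<lparr>carrier := generate I A\<rparr>)"
proof -
  interpret I: group I by (rule group_Isom)
  let ?P = "\<lambda>B. finite B \<and> B \<subseteq> carrier I \<and> generate I B = generate I A"
  obtain B where B: "?P B" and least: "\<And>C. ?P C \<Longrightarrow> card B \<le> card C"
    using ex_has_least_nat[of ?P A card] A by blast
  define n where "n = card B"
  obtain X0 where "bij_betw X0 {1..n} B"
    using ex_bij_betw_nat_finite_1 B n_def by blast
  then have X0: "X0 ` {1..n} = B"
    by (simp add: bij_betw_def)
  obtain X where X: "X ` {1..n} \<subseteq> carrier I" "generate I (X ` {1..n}) = generate I A"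
    "minimal_tuple V E n X"
    using ex_minimal_tuple[of X0 n] X0 B by auto
  have "\<not> elliptic V E (X i)" if i: "i \<in> {1..n}" for i
  proof
    assume "elliptic V E (X i)"
    moreover have "X i \<in> generate I A"
      using generate.incl[of "X i" "X ` {1..n}" I] i X(2) by blast
    ultimately have "X i = \<one>\<^bsub>I\<^esub>" by (rule no_ell[rotated])
    then have "\<one>\<^bsub>I\<^esub> \<in> X ` {1..n}"
      using i by force
    then have "card (X ` {1..n} - {\<one>\<^bsub>I\<^esub>}) < card (X ` {1..n})"
      by (intro card_Diff1_less) auto
    also have "\<dots> \<le> n"
      using card_image_le[of "{1..n}" X] by simp
    finally show False
      using least[of "X ` {1..n} - {\<one>\<^bsub>I\<^esub>}"] I.generate_delete_one[OF X(1)] X n_def by auto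
  qed
  moreover have "\<forall>i\<in>{1..n}. X i \<in> carrier I"
    using X(1) by blast
  ultimately have pp: "ping_pong_hypotheses V E n X"
    using PP[unfolded conjecture_PP_def, rule_format, of V E n X] X(2,3) no_inv tree by auto
  have H: "subgroup (generate I A) I"
    by (rule I.generate_is_subgroup[OF A(2)])
  have "free_basis (I\<lparr>carrier := generate I A\<rparr>) (X ` {1..n})"
    by (rule ping_pong_tuple_free[OF H X(2,1) pp])
  then show ?thesis
    using I.subgroup_imp_group[OF H] unfolding free_group_def by (intro conjI exI)
qed

section \<open>Local freeness of discrete groups\<close>

lemma (in group) subgroup_generated_restrict_carrier:
  assumes "subgroup H G" "A \<subseteq> H"
  shows "subgroup_generated (G\<lparr>carrier := H\<rparr>) A = G\<lparr>carrier := generate G A\<rparr>"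
  using generate_consistent[OF assms(2,1)] assms(2)
  by (simp add: subgroup_generated_def Int_absorb1)

theorem corollary2p7:
  fixes V :: "'v set" and E :: "('v \<times> 'v) set" and \<Gamma> :: "('v \<Rightarrow> 'v) set"
  assumes PP: "conjecture_PP TYPE('v)"
    and tree: "locally_finite_tree V E"
    and discrete: "discrete_subgroup V E \<Gamma>"
    and no_inversions: "without_inversions E \<Gamma>"
  shows "locally_free_group (Isom V E \<lparr>carrier := \<Gamma>\<rparr>) \<longleftrightarrow>
         (\<forall>g\<in>\<Gamma>. elliptic V E g \<longrightarrow> g = \<one>\<^bsub>Isom V E\<^esub>)"
proof -
  have fin: "\<forall>x\<in>V. finite {y. (x, y) \<in> E}"
    using tree by (simp add: locally_finite_tree_def)
  interpret tree V E
    using tree by unfold_locales (simp add: locally_finite_tree_def)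
  interpret I: group I by (rule group_Isom)
  have \<Gamma>: "subgroup \<Gamma> I"
    using discrete by (simp add: discrete_subgroup_def)
  note sub = I.subgroup_generated_restrict_carrier[OF \<Gamma>]
  show ?thesis
  proof (intro iffI ballI impI)
    fix g assume lf: "locally_free_group (I\<lparr>carrier := \<Gamma>\<rparr>)" and g: "g \<in> \<Gamma>" and ell: "elliptic V E g"
    have gI: "g \<in> carrier I"
      using g subgroup.subset[OF \<Gamma>] by blast
    obtain x where x: "x \<in> V" "g x = x"
      using ell elliptic_iff[OF gI] by blast
    let ?H = "I\<lparr>carrier := generate I {g}\<rparr>"
    have "subgroup (stabilizer I (\<lambda>g. g) x) I"
      by (rule group_action.stabilizer_subgroup[OF Isom_action x(1)])
    then have "generate I {g} \<subseteq> stabilizer I (\<lambda>g. g) x"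
      using gI x by (intro I.generate_subgroup_incl) (auto simp: stabilizer_def)
    moreover have "generate I {g} \<subseteq> \<Gamma>"
      using g by (intro I.generate_subgroup_incl[OF _ \<Gamma>]) auto
    ultimately have "finite (generate I {g})"
      using finite_stabilizer[OF fin discrete x(1)] finite_subset by (metis Int_greatest)
    moreover have "free_group ?H"
      using lf[unfolded locally_free_group_def, THEN conjunct2, rule_format, of "{g}"] g sub[of "{g}"] by simp
    ultimately have "generate I {g} = {\<one>\<^bsub>I\<^esub>}"
      using group.finite_free_group_trivial[of ?H] by (simp add: free_group_def)
    then show "g = \<one>\<^bsub>I\<^esub>"
      using generate.incl[of g "{g}" I] by simp
  next
    assume no_ell: "\<forall>g\<in>\<Gamma>. elliptic V E g \<longrightarrow> g = \<one>\<^bsub>I\<^esub>"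
    have "free_group (subgroup_generated (I\<lparr>carrier := \<Gamma>\<rparr>) A)"
      if A: "finite A" "A \<subseteq> \<Gamma>" for A
    proof -
      have "generate I A \<subseteq> \<Gamma>"
        by (rule I.generate_subgroup_incl[OF A(2) \<Gamma>])
      then show ?thesis
        using finitely_generated_free[OF PP A(1)] A(2) subgroup.subset[OF \<Gamma>] no_ell no_inversions
        unfolding sub[OF A(2)] without_inversions_def by blast
    qed
    then show "locally_free_group (I\<lparr>carrier := \<Gamma>\<rparr>)"
      using I.subgroup_imp_group[OF \<Gamma>] by (simp add: locally_free_group_def)
  qed
qed

end
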